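(* Let $n\ge2$ and $a\ge1$ be integers. The algebra $\Bbbk[x_1,\ldots,x_n]/(x_1^a,x_2^a,\ldots,x_n^a,x_1^{a-1}x_2)$ has the SLP.
   Context: $\Bbbk$ is a field of characteristic zero, and $\Bbbk[x_1,\ldots,x_n]$ has the standard grading. A standard graded Artinian algebra $A$ has the strong Lefschetz property (SLP) if there is a linear form $\ell$ such that for all $j\ge1$ and all $i$ the multiplication map $\cdot\ell^j:A_i\to A_{i+j}$ has maximal rank (i.e. is injective or surjective). *)

theory Defs
  imports "HOL-Library.Poly_Mapping" "HOL-Algebra.QuotRing"
begin

text \<open>A monomial is a finitely supported exponent vector; \<^typ>\<open>(nat \<Rightarrow>\<^sub>0 nat) \<Rightarrow>\<^sub>0 'k\<close>
  carries the convolution product, so it is the polynomial ring over \<open>'k\<close> in the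
  indeterminates \<open>x\<^sub>i\<close>, \<open>i :: nat\<close>. The ring \<open>\<k>[x\<^sub>1, \<dots>, x\<^sub>n]\<close> is cut out of it as a carrier.\<close>

type_synonym 'k mpoly = "(nat \<Rightarrow>\<^sub>0 nat) \<Rightarrow>\<^sub>0 'k"

definition indet :: "nat \<Rightarrow> 'k::comm_ring_1 mpoly" where
  "indet i = Poly_Mapping.single (Poly_Mapping.single i 1) 1"

definition mpoly_ring :: "nat \<Rightarrow> ('k::comm_ring_1 mpoly) ring" where
  "mpoly_ring n =
     \<lparr>carrier = {p. \<forall>m \<in> Poly_Mapping.keys p. Poly_Mapping.keys m \<subseteq> {1..n}},
      mult = (*), one = 1, zero = 0, add = (+)\<rparr>"

definition mon_degree :: "(nat \<Rightarrow>\<^sub>0 nat) \<Rightarrow> nat" where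
  "mon_degree m = (\<Sum>i \<in> Poly_Mapping.keys m. Poly_Mapping.lookup m i)"

definition forms :: "nat \<Rightarrow> nat \<Rightarrow> ('k::comm_ring_1 mpoly) set" where
  "forms n d =
     {p \<in> carrier (mpoly_ring n). \<forall>m \<in> Poly_Mapping.keys p. mon_degree m = d}"

definition homogeneous_ideal :: "nat \<Rightarrow> ('k::comm_ring_1 mpoly) set \<Rightarrow> bool" where
  "homogeneous_ideal n I \<longleftrightarrow>
     (\<exists>S \<subseteq> (\<Union>d. forms n d). I = Idl\<^bsub>mpoly_ring n\<^esub> S)"

definition graded_part :: "nat \<Rightarrow> ('k::comm_ring_1 mpoly) set \<Rightarrow> nat \<Rightarrow> ('k mpoly) set set" where
  "graded_part n I d = (\<lambda>p. I +>\<^bsub>mpoly_ring n\<^esub> p) ` forms n d"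

locale artinian_ring = ring +
  assumes descending_chain_condition:
    "\<lbrakk>\<And>i::nat. ideal (J i) R; \<And>i. J (Suc i) \<subseteq> J i\<rbrakk> \<Longrightarrow> \<exists>N. \<forall>i\<ge>N. J i = J N"

text \<open>The strong Lefschetz property of the standard graded algebra
  \<open>A = \<k>[x\<^sub>1, \<dots>, x\<^sub>n] / I\<close>. The notion is only meant for Artinian \<open>A\<close> and homogeneous \<open>I\<close>,
  so both are part of the predicate.\<close>

definition has_SLP :: "nat \<Rightarrow> ('k::field mpoly) set \<Rightarrow> bool" where
  "has_SLP n I \<longleftrightarrow>
     homogeneous_ideal n I \<and>
     artinian_ring (mpoly_ring n Quot I) \<and>
     (\<exists>l \<in> graded_part n I 1. \<forall>j\<ge>1. \<forall>i.
        let \<phi> = (\<lambda>u. (l [^]\<^bsub>mpoly_ring n Quot I\<^esub> j) \<otimes>\<^bsub>mpoly_ring n Quot I\<^esub> u)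
        in inj_on \<phi> (graded_part n I i) \<or>
           \<phi> ` graded_part n I i = graded_part n I (i + j))"

end

theory Submission
  imports Defs Complex_Main
begin

text \<open>
  Let \<open>P\<close> be the polynomial ring, \<open>\<ell> = x\<^sub>1 + \<dots> + x\<^sub>n\<close>, and \<open>J\<close> the ideal of the theorem.
  For a monomial complete intersection \<open>B = P / (x\<^sub>1^d\<^sub>1, \<dots>, x\<^sub>n^d\<^sub>n)\<close> of socle degree
  \<open>s = \<Sum>(d\<^sub>i - 1)\<close>, the operator \<open>F = \<Sum>((d\<^sub>i - 1) \<partial>\<^sub>i - x\<^sub>i \<partial>\<^sub>i^2)\<close> preserves the ideal and
  satisfies \<open>F (\<ell> p) = \<ell> F p + (s - 2 deg p) p\<close>. As in the representation theory of
  \<open>sl\<^sub>2\<close>, this makes \<open>\<ell>^j : B\<^sub>i \<rightarrow> B\<^sub>i\<^sub>+\<^sub>j\<close> injective if \<open>2i + j \<le> s\<close> and surjective if \<open>2i + j \<ge> s\<close>.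

  Both ends of the exact sequence
  \<open>0 \<rightarrow> P / (J : x\<^sub>1^(a-1)) \<rightarrow> P / J \<rightarrow> P / (J, x\<^sub>1^(a-1)) \<rightarrow> 0\<close>, whose first map is
  multiplication by \<open>x\<^sub>1^(a-1)\<close>, are such algebras: the ideals are \<open>(x\<^sub>1, x\<^sub>2, x\<^sub>3^a, \<dots>, x\<^sub>n^a)\<close>
  and \<open>(x\<^sub>1^(a-1), x\<^sub>2^a, \<dots>, x\<^sub>n^a)\<close>. After the shift by \<open>a - 1\<close> their Hilbert functions are
  symmetric about \<open>n(a-1)/2\<close> and \<open>(n(a-1)-1)/2\<close>. Since these centres differ by only \<open>1/2\<close>, for
  all \<open>i\<close> and \<open>j\<close> the map \<open>\<ell>^j\<close> is injective on both ends or surjective on both ends, hence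
  so on \<open>P / J\<close>.
\<close>

subsection \<open>Polynomials supported on a set of monomials\<close>

definition mons :: "nat \<Rightarrow> (nat \<Rightarrow>\<^sub>0 nat) set" where
  "mons n = {m. Poly_Mapping.keys m \<subseteq> {1..n}}"

text \<open>The carrier, the graded pieces and all monomial ideals below are sets of this form, so
  membership in each becomes a condition on exponents.\<close>

definition polys_on :: "(nat \<Rightarrow>\<^sub>0 nat) set \<Rightarrow> 'k::comm_ring_1 mpoly set" where
  "polys_on U = {p. Poly_Mapping.keys p \<subseteq> U}"

lemma polys_on_iff_lookup: "p \<in> polys_on U \<longleftrightarrow> (\<forall>m. m \<notin> U \<longrightarrow> Poly_Mapping.lookup p m = 0)"
  by (auto simp: polys_on_def in_keys_iff)

lemma carrier_mpoly_ring: "carrier (mpoly_ring n) = polys_on (mons n)"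
  by (auto simp: mpoly_ring_def polys_on_def mons_def)

lemma forms_eq_polys_on: "forms n d = polys_on {m \<in> mons n. mon_degree m = d}"
  by (auto simp: forms_def carrier_mpoly_ring polys_on_def)

lemma polys_on_mono: "p \<in> polys_on U \<Longrightarrow> U \<subseteq> W \<Longrightarrow> p \<in> polys_on W"
  by (auto simp: polys_on_def)

lemma polys_on_zero [simp]: "0 \<in> polys_on U"
  and polys_on_add: "p \<in> polys_on U \<Longrightarrow> q \<in> polys_on U \<Longrightarrow> p + q \<in> polys_on U"
  and polys_on_uminus: "p \<in> polys_on U \<Longrightarrow> - p \<in> polys_on U"
  and polys_on_diff: "p \<in> polys_on U \<Longrightarrow> q \<in> polys_on U \<Longrightarrow> p - q \<in> polys_on U"
  by (auto simp: polys_on_iff_lookup lookup_add lookup_minus)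

lemma polys_on_single: "m \<in> U \<Longrightarrow> Poly_Mapping.single m c \<in> polys_on U"
  by (auto simp: polys_on_iff_lookup lookup_single when_def)

lemma polys_on_sum: "(\<And>i. i \<in> A \<Longrightarrow> f i \<in> polys_on U) \<Longrightarrow> sum f A \<in> polys_on U"
  by (induction A rule: infinite_finite_induct) (auto intro: polys_on_add)

lemma polys_on_mult:
  assumes "p \<in> polys_on U" "q \<in> polys_on W" "\<And>u w. u \<in> U \<Longrightarrow> w \<in> W \<Longrightarrow> u + w \<in> X"
  shows "p * q \<in> polys_on X"
  using assms keys_mult[of p q] unfolding polys_on_def by fastforce

lemma poly_mapping_sum_single:
  "p = (\<Sum>m\<in>Poly_Mapping.keys p. Poly_Mapping.single m (Poly_Mapping.lookup p m))"
  by (rule poly_mapping_eqI) (auto simp: lookup_sum lookup_single when_def in_keys_iff)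

lemma polys_on_induct [consumes 1, case_names zero single add]:
  assumes "p \<in> polys_on U" "P 0" "\<And>m c. m \<in> U \<Longrightarrow> P (Poly_Mapping.single m c)"
    and "\<And>p q. P p \<Longrightarrow> P q \<Longrightarrow> P (p + q)"
  shows "P p"
proof -
  have "P (\<Sum>m\<in>A. Poly_Mapping.single m (Poly_Mapping.lookup p m))" if "finite A" "A \<subseteq> U" for A
    using that by (induction A rule: finite_induct) (auto intro: assms)
  with assms(1) show ?thesis
    by (subst poly_mapping_sum_single) (auto simp: polys_on_def)
qed

section \<open>Exponent vectors and degrees\<close>

lemma mons_closed:
  "0 \<in> mons n" "m \<in> mons n \<Longrightarrow> m' \<in> mons n \<Longrightarrow> m + m' \<in> mons n"
  "i \<in> {1..n} \<Longrightarrow> Poly_Mapping.single i k \<in> mons n"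
  using Poly_Mapping.keys_add[of m m'] by (auto simp: mons_def)

lemma mons_add_iff: "m + m' \<in> mons n \<longleftrightarrow> m \<in> mons n \<and> m' \<in> mons n"
  by (auto simp: mons_def in_keys_iff lookup_add subset_iff)

lemma mon_degree_eq: "m \<in> mons n \<Longrightarrow> mon_degree m = (\<Sum>i=1..n. Poly_Mapping.lookup m i)"
  unfolding mon_degree_def mons_def by (rule sum.mono_neutral_left) (auto simp: in_keys_iff)

lemma mon_degree_add: "mon_degree (m + m') = mon_degree m + mon_degree m'"
proof -
  obtain A where A: "finite A" "Poly_Mapping.keys m \<union> Poly_Mapping.keys m' \<subseteq> A"
    using finite_keys by (metis finite_UnI order_refl)
  have *: "mon_degree k = (\<Sum>i\<in>A. Poly_Mapping.lookup k i)" if "Poly_Mapping.keys k \<subseteq> A" for k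
    unfolding mon_degree_def using A that
    by (intro sum.mono_neutral_left) (auto simp: in_keys_iff)
  show ?thesis
    using A Poly_Mapping.keys_add[of m m'] by (simp add: * lookup_add sum.distrib subset_trans)
qed

lemma mon_degree_single [simp]: "mon_degree (Poly_Mapping.single i k) = k"
  by (simp add: mon_degree_def)

lemma mon_degree_zero [simp]: "mon_degree 0 = 0"
  by (simp add: mon_degree_def)

lemma forms_mult: "p \<in> forms n i \<Longrightarrow> q \<in> forms n j \<Longrightarrow> p * q \<in> forms n (i + j)"
  unfolding forms_eq_polys_on by (erule (1) polys_on_mult) (auto simp: mons_closed mon_degree_add)

lemma forms_one: "1 \<in> forms n 0"
  unfolding forms_eq_polys_on single_one[symmetric] by (rule polys_on_single) (auto simp: mons_closed)

lemma forms_power: "p \<in> forms n i \<Longrightarrow> p ^ j \<in> forms n (j * i)"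
  by (induction j) (auto simp: forms_one dest: forms_mult)

section \<open>The polynomial ring and its monomial ideals\<close>

lemma cring_mpoly_ring: "cring (mpoly_ring n :: 'k::comm_ring_1 mpoly ring)"
proof (rule cringI)
  show "abelian_group (mpoly_ring n :: 'k mpoly ring)"
  proof (rule abelian_groupI)
    fix x :: "'k mpoly"
    assume "x \<in> carrier (mpoly_ring n)"
    then show "\<exists>y\<in>carrier (mpoly_ring n). y \<oplus>\<^bsub>mpoly_ring n\<^esub> x = \<zero>\<^bsub>mpoly_ring n\<^esub>"
      by (intro bexI[of _ "- x"]) (auto simp: carrier_mpoly_ring polys_on_uminus, simp add: mpoly_ring_def)
  qed (auto simp: carrier_mpoly_ring, auto simp: mpoly_ring_def polys_on_add add_ac)
  show "comm_monoid (mpoly_ring n :: 'k mpoly ring)"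
  proof (rule comm_monoidI)
    show "\<one>\<^bsub>mpoly_ring n\<^esub> \<in> carrier (mpoly_ring n :: 'k mpoly ring)"
      using forms_one[of n] by (auto simp: forms_def mpoly_ring_def)
  qed (auto simp: carrier_mpoly_ring,
       auto simp: mpoly_ring_def mult_ac intro: polys_on_mult mons_closed)
qed (simp add: mpoly_ring_def distrib_right)

lemma ring_mpoly_ring: "ring (mpoly_ring n :: 'k::comm_ring_1 mpoly ring)"
  using cring_mpoly_ring by (rule cring.axioms)

lemma mpoly_ring_simps:
  "(p \<otimes>\<^bsub>mpoly_ring n\<^esub> q) = p * q" "(p \<oplus>\<^bsub>mpoly_ring n\<^esub> q) = p + q"
  "\<one>\<^bsub>mpoly_ring n\<^esub> = 1" "\<zero>\<^bsub>mpoly_ring n\<^esub> = 0"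
  by (simp_all add: mpoly_ring_def)

lemma mpoly_ring_uminus:
  assumes "p \<in> carrier (mpoly_ring n)"
  shows "\<ominus>\<^bsub>mpoly_ring n\<^esub> p = - p"
proof -
  interpret ring "mpoly_ring n" by (rule ring_mpoly_ring)
  show ?thesis
    using assms by (intro minus_equality) (auto simp: carrier_mpoly_ring polys_on_uminus mpoly_ring_simps)
qed

lemma mpoly_ring_diff:
  assumes "q \<in> carrier (mpoly_ring n)"
  shows "p \<ominus>\<^bsub>mpoly_ring n\<^esub> q = p - q"
  using assms by (simp add: a_minus_def mpoly_ring_uminus mpoly_ring_simps)

lemma ideal_polys_on:
  fixes n :: nat
  assumes "U \<subseteq> mons n" "\<And>u m. u \<in> U \<Longrightarrow> m \<in> mons n \<Longrightarrow> m + u \<in> U"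
  shows "ideal (polys_on U :: 'k::comm_ring_1 mpoly set) (mpoly_ring n)"
proof (rule idealI)
  interpret ring "mpoly_ring n :: 'k mpoly ring" by (rule ring_mpoly_ring)
  show "subgroup (polys_on U :: 'k mpoly set) (add_monoid (mpoly_ring n))"
    unfolding a_inv_def[symmetric]
  proof (rule add.subgroupI)
    show "polys_on U \<subseteq> carrier (mpoly_ring n)"
      using assms(1) by (auto simp: carrier_mpoly_ring intro: polys_on_mono)
    then show "\<ominus>\<^bsub>mpoly_ring n\<^esub> p \<in> polys_on U" if "p \<in> polys_on U" for p :: "'k mpoly"
      using that by (subst mpoly_ring_uminus) (auto intro: polys_on_uminus)
  qed (auto simp: mpoly_ring_simps intro: polys_on_add, use polys_on_zero in blast)
  fix p x :: "'k mpoly"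
  assume "p \<in> polys_on U" "x \<in> carrier (mpoly_ring n)"
  then have *: "x * p \<in> polys_on U"
    unfolding carrier_mpoly_ring by (intro polys_on_mult[of x _ p]) (auto intro: assms)
  then show "x \<otimes>\<^bsub>mpoly_ring n\<^esub> p \<in> polys_on U" "p \<otimes>\<^bsub>mpoly_ring n\<^esub> x \<in> polys_on U"
    by (simp_all add: mpoly_ring_simps mult.commute)
qed (rule ring_mpoly_ring)

text \<open>One inclusion is minimality of the generated ideal, since the exponents on the right are
  closed under adding monomials. For the other, each term over such an exponent is a multiple of a
  generator.\<close>

lemma genideal_monomials:
  fixes n :: nat and G :: "(nat \<Rightarrow>\<^sub>0 nat) set"
  assumes G: "G \<subseteq> mons n"
  shows "Idl\<^bsub>mpoly_ring n\<^esub> ((\<lambda>g. Poly_Mapping.single g 1) ` G)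
           = (polys_on {g + m | g m. g \<in> G \<and> m \<in> mons n} :: 'k::comm_ring_1 mpoly set)"
    (is "Idl\<^bsub>_\<^esub> ?S = polys_on ?U")
proof
  interpret ring "mpoly_ring n :: 'k mpoly ring" by (rule ring_mpoly_ring)
  have id: "ideal (polys_on ?U) (mpoly_ring n)"
  proof (rule ideal_polys_on)
    show "m + u \<in> ?U" if "u \<in> ?U" "m \<in> mons n" for u m
      using that by (smt (verit) add.assoc add.commute mem_Collect_eq mons_closed(2))
  qed (use G in \<open>auto simp: mons_closed\<close>)
  have "g \<in> ?U" if "g \<in> G" for g
    using that mons_closed(1)[of n] by (metis (mono_tags, lifting) add.right_neutral mem_Collect_eq)
  then show "Idl\<^bsub>mpoly_ring n\<^esub> ?S \<subseteq> polys_on ?U"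
    by (intro genideal_minimal id) (auto intro: polys_on_single)
  have S: "?S \<subseteq> carrier (mpoly_ring n)"
    using G by (auto simp: carrier_mpoly_ring intro: polys_on_single)
  interpret I: ideal "Idl\<^bsub>mpoly_ring n\<^esub> ?S" "mpoly_ring n"
    by (rule genideal_ideal[OF S])
  show "polys_on ?U \<subseteq> Idl\<^bsub>mpoly_ring n\<^esub> ?S"
  proof
    fix p :: "'k mpoly"
    assume "p \<in> polys_on ?U"
    then show "p \<in> Idl\<^bsub>mpoly_ring n\<^esub> ?S"
    proof (induction rule: polys_on_induct)
      case zero
      show ?case using I.zero_closed by (simp add: mpoly_ring_simps)
    next
      case (add p q)
      then show ?case using I.a_closed by (simp add: mpoly_ring_simps)
    next
      case (single m c)
      then obtain g h where m: "m = g + h" "g \<in> G" "h \<in> mons n" by blast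
      have "Poly_Mapping.single g 1 \<otimes>\<^bsub>mpoly_ring n\<^esub> Poly_Mapping.single h c \<in> Idl\<^bsub>mpoly_ring n\<^esub> ?S"
        using m genideal_self[OF S]
        by (intro I.I_r_closed) (auto simp: carrier_mpoly_ring intro: polys_on_single)
      then show ?case by (simp add: m mpoly_ring_simps mult_single)
    qed
  qed
qed

subsection \<open>Monomial complete intersections\<close>

definition linear_form :: "nat \<Rightarrow> 'k::comm_ring_1 mpoly" where
  "linear_form n = (\<Sum>i=1..n. indet i)"

text \<open>The coefficient in \<open>((d - 1) \<partial> - x \<partial>^2) x^t = t (d - t) x^(t-1)\<close>; truncation in
  \<open>m - Poly_Mapping.single i 1\<close> is harmless below because the coefficient vanishes at \<open>t = 0\<close>.\<close>

definition lowering_coeff :: "nat \<Rightarrow> nat \<Rightarrow> int" where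
  "lowering_coeff d t = int t * (int d - int t)"

definition lowering_monomial ::
  "nat \<Rightarrow> (nat \<Rightarrow> nat) \<Rightarrow> (nat \<Rightarrow>\<^sub>0 nat) \<Rightarrow> 'k::comm_ring_1 \<Rightarrow> 'k mpoly" where
  "lowering_monomial n d m c =
     (\<Sum>i=1..n. Poly_Mapping.single (m - Poly_Mapping.single i 1)
        (of_int (lowering_coeff (d i) (Poly_Mapping.lookup m i)) * c))"

text \<open>The operator \<open>F\<close> of the overview, extended additively from single terms;
  \<open>d\<close> lists the exponents of the pure powers.\<close>

definition lowering :: "nat \<Rightarrow> (nat \<Rightarrow> nat) \<Rightarrow> 'k::comm_ring_1 mpoly \<Rightarrow> 'k mpoly" where
  "lowering n d p = (\<Sum>m\<in>Poly_Mapping.keys p. lowering_monomial n d m (Poly_Mapping.lookup p m))"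

lemma lowering_coeff_0 [simp]: "lowering_coeff d 0 = 0"
  by (simp add: lowering_coeff_def)

lemma lowering_monomial_0 [simp]: "lowering_monomial n d m 0 = 0"
  by (simp add: lowering_monomial_def)

lemma lowering_monomial_add:
  "lowering_monomial n d m (c + c') = lowering_monomial n d m c + lowering_monomial n d m c'"
  by (simp add: lowering_monomial_def single_add distrib_left sum.distrib)

text \<open>Zero coefficients contribute nothing, so the sum may run over a support common to
  several polynomials; additivity rests on this.\<close>

lemma lowering_superset:
  assumes "finite A" "Poly_Mapping.keys p \<subseteq> A"
  shows "lowering n d p = (\<Sum>m\<in>A. lowering_monomial n d m (Poly_Mapping.lookup p m))"
  unfolding lowering_def using assms by (intro sum.mono_neutral_left) (auto simp: in_keys_iff)

lemma lowering_0 [simp]: "lowering n d 0 = 0"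
  by (simp add: lowering_def)

lemma lowering_single: "lowering n d (Poly_Mapping.single m c) = lowering_monomial n d m c"
  by (subst lowering_superset[of "{m}"]) auto

lemma lowering_add: "lowering n d (p + q) = lowering n d p + lowering n d q"
proof -
  let ?A = "Poly_Mapping.keys p \<union> Poly_Mapping.keys q"
  have "Poly_Mapping.keys (p + q) \<subseteq> ?A" by (rule Poly_Mapping.keys_add)
  then show ?thesis
    by (simp add: lowering_superset[of ?A] lookup_add lowering_monomial_add sum.distrib)
qed

lemma lowering_diff: "lowering n d (p - q) = lowering n d p - lowering n d q"
  using lowering_add[of n d "p - q" q] by (simp add: algebra_simps)

lemma lowering_sum: "lowering n d (sum f A) = (\<Sum>x\<in>A. lowering n d (f x))"
  by (induction A rule: infinite_finite_induct) (auto simp: lowering_add)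

lemma mons_diff: "m \<in> mons n \<Longrightarrow> m - m' \<in> mons n"
  by (auto simp: mons_def in_keys_iff lookup_minus subset_iff)

lemma diff_single_add_single:
  "Poly_Mapping.lookup m i > 0 \<Longrightarrow>
     (m - Poly_Mapping.single i 1) + Poly_Mapping.single i 1 = (m :: nat \<Rightarrow>\<^sub>0 nat)"
  by (rule poly_mapping_eqI) (auto simp: lookup_add lookup_minus lookup_single when_def)

lemma mon_degree_diff_single:
  "Poly_Mapping.lookup m i > 0 \<Longrightarrow> mon_degree (m - Poly_Mapping.single i 1) = mon_degree m - 1"
  by (metis diff_single_add_single mon_degree_add mon_degree_single diff_add_inverse2)

text \<open>The coefficient t (d - t) vanishes at t = 0 and t = \<open>d i\<close>, so these cases
  are exempt. The exemption at t = \<open>d i\<close> is what keeps the ideal of pure powers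
  stable.\<close>

lemma lowering_monomial_polys_on:
  assumes "\<And>i. i \<in> {1..n} \<Longrightarrow> Poly_Mapping.lookup m i > 0 \<Longrightarrow> Poly_Mapping.lookup m i \<noteq> d i
      \<Longrightarrow> m - Poly_Mapping.single i 1 \<in> U"
  shows "lowering_monomial n d m c \<in> polys_on U"
  unfolding lowering_monomial_def
proof (rule polys_on_sum)
  fix i assume i: "i \<in> {1..n}"
  show "Poly_Mapping.single (m - Poly_Mapping.single i 1)
      (of_int (lowering_coeff (d i) (Poly_Mapping.lookup m i)) * c) \<in> polys_on U"
  proof (cases "Poly_Mapping.lookup m i = 0 \<or> Poly_Mapping.lookup m i = d i")
    case True
    then show ?thesis by (auto simp: lowering_coeff_def)
  next
    case False
    then show ?thesis using assms[OF i] by (intro polys_on_single) auto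
  qed
qed

lemma lowering_forms_Suc: "p \<in> forms n (Suc i) \<Longrightarrow> lowering n d p \<in> forms n i"
  unfolding forms_eq_polys_on
  by (induction rule: polys_on_induct)
     (auto simp: lowering_add lowering_single mons_diff mon_degree_diff_single[simplified]
       intro!: polys_on_add lowering_monomial_polys_on)

lemma lowering_forms_0:
  assumes "p \<in> forms n 0"
  shows "lowering n d p = 0"
proof -
  \<comment> \<open>Only 0 has empty support; vanishing is phrased this way so that the support
    lemma applies.\<close>
  have "lowering n d p \<in> polys_on {}" using assms
    unfolding forms_eq_polys_on
  proof (induction rule: polys_on_induct)
    case (single m c)
    then have "Poly_Mapping.lookup m i = 0" if "i \<in> {1..n}" for i
      using that by (auto simp: mon_degree_eq)
    then show ?case by (auto simp: lowering_single intro!: lowering_monomial_polys_on)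
  qed (auto simp: lowering_add intro: polys_on_add)
  then show ?thesis by (simp add: polys_on_def)
qed

text \<open>Exponents of the ideal (x_1^d_1, ..., x_n^d_n); the remaining monomials fill a box and
  represent a basis of the quotient.\<close>

definition outside_box :: "nat \<Rightarrow> (nat \<Rightarrow> nat) \<Rightarrow> (nat \<Rightarrow>\<^sub>0 nat) set" where
  "outside_box n d = {m \<in> mons n. \<exists>i\<in>{1..n}. d i \<le> Poly_Mapping.lookup m i}"

lemma outside_box_mult:
  "p \<in> polys_on (mons n) \<Longrightarrow> q \<in> polys_on (outside_box n d) \<Longrightarrow> p * q \<in> polys_on (outside_box n d)"
  by (erule (1) polys_on_mult)
     (auto simp: outside_box_def mons_closed lookup_add intro!: bexI trans_le_add2)

text \<open>Lowering can leave the ideal only from an exponent equal to \<open>d k\<close>, and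
  there the coefficient is 0. Lowering another variable leaves the witness \<open>k\<close>
  intact.\<close>

lemma lowering_outside_box:
  assumes "p \<in> polys_on (outside_box n d)"
  shows "lowering n d p \<in> polys_on (outside_box n d)"
  using assms
proof (induction rule: polys_on_induct)
  case (single m c)
  then obtain k where k: "m \<in> mons n" "k \<in> {1..n}" "d k \<le> Poly_Mapping.lookup m k"
    by (auto simp: outside_box_def)
  have "m - Poly_Mapping.single i 1 \<in> outside_box n d"
    if "Poly_Mapping.lookup m i \<noteq> d i" for i
    unfolding outside_box_def using k that
    by (cases "i = k") (auto simp: mons_diff lookup_minus lookup_single when_def intro!: bexI[of _ k])
  then show ?case
    by (auto simp: lowering_single intro!: lowering_monomial_polys_on)
qed (auto simp: lowering_add intro: polys_on_add)

lemma linear_form_forms: "linear_form n \<in> forms n 1"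
  unfolding forms_eq_polys_on linear_form_def indet_def
  by (intro polys_on_sum polys_on_single) (auto simp: mons_closed)

text \<open>An integer, since a box may have an empty side (\<open>d i = 0\<close>); this occurs below for \<open>a = 1\<close>.\<close>

definition socle_degree :: "nat \<Rightarrow> (nat \<Rightarrow> nat) \<Rightarrow> int" where
  "socle_degree n d = (\<Sum>i=1..n. int (d i) - 1)"

lemma single_sum: "Poly_Mapping.single m (sum f A) = (\<Sum>x\<in>A. Poly_Mapping.single m (f x))"
  by (induction A rule: infinite_finite_induct) (auto simp: single_add)

text \<open>Multiplying by x_i commutes with the x_j-part of \<open>F\<close> for distinct i and j.
  For i = j the commutator scales the monomial by d_i - 1 - 2t, t being its exponent at i; these
  scalars add up to the socle degree minus twice the degree.\<close>

lemma lowering_linear_form_single: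
  assumes m: "m \<in> mons n"
  shows "lowering n d (linear_form n * Poly_Mapping.single m c) =
    linear_form n * lowering n d (Poly_Mapping.single m c)
    + of_int (socle_degree n d - 2 * int (mon_degree m)) * Poly_Mapping.single m c"
proof -
  let ?e = "\<lambda>i. Poly_Mapping.single i (1::nat)"
  let ?l = "Poly_Mapping.lookup"
  let ?f = "\<lambda>i j. Poly_Mapping.single (m + ?e i - ?e j)
              (of_int (lowering_coeff (d j) (?l (m + ?e i) j)) * c)"
  let ?g = "\<lambda>i j. Poly_Mapping.single (m - ?e j + ?e i)
              (of_int (lowering_coeff (d j) (?l m j)) * c)"
  have 1: "lowering n d (linear_form n * Poly_Mapping.single m c) = (\<Sum>i=1..n. \<Sum>j=1..n. ?f i j)"
    by (simp add: linear_form_def indet_def sum_distrib_right mult_single lowering_sum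
        lowering_single lowering_monomial_def add.commute)
  have 2: "linear_form n * lowering n d (Poly_Mapping.single m c) = (\<Sum>i=1..n. \<Sum>j=1..n. ?g i j)"
    by (simp add: linear_form_def indet_def sum_product mult_single
        lowering_single lowering_monomial_def add.commute)
  \<comment> \<open>If x_j does not occur in \<open>m\<close>, truncated subtraction may give
    different exponents, but both coefficients are 0.\<close>
  have off: "?f i j = ?g i j" if "i \<noteq> j" for i j
  proof (cases "?l m j = 0")
    case True
    then show ?thesis using that by (simp add: lookup_add lookup_single)
  next
    case False
    have "m + ?e i - ?e j = m - ?e j + ?e i"
      using False by (intro poly_mapping_eqI) (auto simp: lookup_add lookup_minus lookup_single when_def)
    then show ?thesis using that by (simp add: lookup_add lookup_single)
  qed
  have diag: "?f i i - ?g i i =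
      Poly_Mapping.single m (of_int (int (d i) - 1 - 2 * int (?l m i)) * c)" for i
  proof -
    \<comment> \<open>At exponent 0 subtracting and adding back does not restore \<open>m\<close>,
      but both sides are then 0.\<close>
    have g: "?g i i = Poly_Mapping.single m (of_int (lowering_coeff (d i) (?l m i)) * c)"
      by (cases "?l m i = 0") (use diff_single_add_single[of m i] in auto)
    have "m + ?e i - ?e i = m" by simp
    moreover have "lowering_coeff (d i) (?l m i + 1) - lowering_coeff (d i) (?l m i)
        = int (d i) - 1 - 2 * int (?l m i)"
      by (simp add: lowering_coeff_def algebra_simps)
    ultimately show ?thesis
      unfolding g by (simp add: lookup_add single_diff[symmetric] left_diff_distrib[symmetric]
          of_int_diff[symmetric] del: of_int_diff)
  qed
  have "(\<Sum>i=1..n. \<Sum>j=1..n. ?f i j) - (\<Sum>i=1..n. \<Sum>j=1..n. ?g i j)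
      = (\<Sum>i=1..n. \<Sum>j=1..n. ?f i j - ?g i j)"
    by (simp only: sum_subtractf)
  also have "\<dots> = (\<Sum>i=1..n. \<Sum>j=1..n. if i = j then ?f i i - ?g i i else 0)"
    by (intro sum.cong refl) (use off in auto)
  also have "\<dots> = (\<Sum>i=1..n. ?f i i - ?g i i)"
    by (intro sum.cong) auto
  also have "\<dots> = Poly_Mapping.single m ((\<Sum>i=1..n. of_int (int (d i) - 1 - 2 * int (?l m i))) * c)"
    by (simp only: diag single_sum[symmetric] sum_distrib_right)
  also have "(\<Sum>i=1..n. of_int (int (d i) - 1 - 2 * int (?l m i)) :: 'a)
       = of_int (socle_degree n d - 2 * int (mon_degree m))"
    by (simp only: of_int_sum[symmetric] mon_degree_eq[OF m] socle_degree_def)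
       (simp add: sum_subtractf sum_distrib_left)
  also have "Poly_Mapping.single m (of_int (socle_degree n d - 2 * int (mon_degree m)) * c)
     = of_int (socle_degree n d - 2 * int (mon_degree m)) * Poly_Mapping.single m c"
    using mult_single[of 0 "of_int (socle_degree n d - 2 * int (mon_degree m))" m c]
    by (simp del: of_int_diff)
  finally show ?thesis unfolding 1 2 by (simp add: algebra_simps)
qed

lemma lowering_linear_form:
  assumes "p \<in> forms n i"
  shows "lowering n d (linear_form n * p) =
    linear_form n * lowering n d p + of_int (socle_degree n d - 2 * int i) * p"
  using assms unfolding forms_eq_polys_on
proof (induction rule: polys_on_induct)
  case (single m c)
  then show ?case using lowering_linear_form_single[of m n d c] by simp
next
  case (add p q)
  then show ?case by (simp add: distrib_left lowering_add algebra_simps)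
qed simp

text \<open>Moving \<open>F\<close> past the k + 1 factors one by one produces the scalars s - 2 (i
  + t) for t = 0, ..., k, whose sum is (k + 1) (s - 2i - k).\<close>

lemma lowering_linear_form_power:
  assumes p: "p \<in> forms n i"
  shows "lowering n d (linear_form n ^ Suc k * p) = linear_form n ^ Suc k * lowering n d p
    + of_int (int (Suc k) * (socle_degree n d - 2 * int i - int k)) * (linear_form n ^ k * p)"
proof (induction k)
  case 0
  show ?case using lowering_linear_form[OF p] by simp
next
  case (Suc k)
  let ?l = "linear_form n" and ?s = "socle_degree n d"
  have "?l ^ Suc k * p \<in> forms n (Suc k + i)"
    using forms_mult[OF forms_power[OF linear_form_forms, of n "Suc k"] p] by simp
  from lowering_linear_form[OF this, of d]
  have "lowering n d (?l ^ Suc (Suc k) * p) = ?l * lowering n d (?l ^ Suc k * p)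
      + of_int (?s - 2 * int (Suc k + i)) * (?l ^ Suc k * p)"
    by (simp add: mult.assoc)
  also have "\<dots> = ?l ^ Suc (Suc k) * lowering n d p
      + (of_int (int (Suc k) * (?s - 2 * int i - int k)) + of_int (?s - 2 * int (Suc k + i)))
        * (?l ^ Suc k * p)"
    unfolding Suc.IH by (simp only: distrib_left distrib_right power_Suc mult_ac add_ac)
  also have "of_int (int (Suc k) * (?s - 2 * int i - int k)) + of_int (?s - 2 * int (Suc k + i))
      = (of_int (int (Suc (Suc k)) * (?s - 2 * int i - int (Suc k))) :: 'a mpoly)"
    unfolding of_int_add[symmetric] by (rule arg_cong[of _ _ of_int]) (simp add: algebra_simps)
  finally show ?case .
qed

text \<open>Inside the box each exponent is at most d_k - 1, which bounds the degree by the socle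
  degree.\<close>

lemma forms_gt_socle_degree:
  assumes "p \<in> forms n i" "int i > socle_degree n d"
  shows "p \<in> polys_on (outside_box n d)"
proof (rule polys_on_mono)
  show "p \<in> polys_on {m \<in> mons n. mon_degree m = i}"
    using assms(1) by (simp add: forms_eq_polys_on)
  show "{m \<in> mons n. mon_degree m = i} \<subseteq> outside_box n d"
  proof safe
    fix m assume m: "m \<in> mons n" "i = mon_degree m"
    show "m \<in> outside_box n d"
    proof (rule ccontr)
      assume "m \<notin> outside_box n d"
      with m have "\<forall>k\<in>{1..n}. int (Poly_Mapping.lookup m k) \<le> int (d k) - 1"
        by (force simp: outside_box_def)
      then have "(\<Sum>k=1..n. int (Poly_Mapping.lookup m k)) \<le> socle_degree n d"
        unfolding socle_degree_def by (intro sum_mono) auto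
      with assms(2) m show False by (simp add: mon_degree_eq)
    qed
  qed
qed

text \<open>Characteristic zero enters here: the scalars in the commutator formula can be divided
  out once they are nonzero.\<close>

lemma of_int_unit_mpoly:
  assumes "c \<noteq> 0"
  obtains u :: "'k::field_char_0 mpoly" where "u \<in> forms n 0" "u * of_int c = 1"
proof
  show "Poly_Mapping.single 0 (inverse (of_int c)) \<in> (forms n 0 :: 'k mpoly set)"
    unfolding forms_eq_polys_on by (rule polys_on_single) (auto simp: mons_closed)
  show "Poly_Mapping.single 0 (inverse (of_int c)) * of_int c = (1 :: 'k mpoly)"
    using mult_single[of 0 "inverse (of_int c)" 0 "of_int c :: 'k"] assms by simp
qed

section \<open>Lefschetz maps of a complete intersection\<close>

lemma forms_polys_on_mons: "p \<in> forms n i \<Longrightarrow> p \<in> polys_on (mons n)"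
  unfolding forms_eq_polys_on by (erule polys_on_mono) auto

lemma forms_power_polys_on_mons: "p \<in> forms n i \<Longrightarrow> p ^ j \<in> polys_on (mons n)"
  by (rule forms_polys_on_mons[OF forms_power])

lemma of_int_mult_polys_on: "p \<in> polys_on U \<Longrightarrow> of_int c * p \<in> polys_on U"
  using polys_on_mult[OF polys_on_single[of 0 "{0}" "of_int c"], of p U U]
  by (simp only: single_of_int singleton_iff add_0 simp_thms)

text \<open>Induction on the degree. If \<open>F p\<close> lies in the ideal, the commutator formula
  strips the factors \<ell> off \<ell>^j p one at a time. That \<open>F p\<close> lies there follows
  from the induction hypothesis, applied to \<open>F p\<close> with one more factor \<ell>.\<close>

lemma box_injective:
  fixes p :: "'k::field_char_0 mpoly"
  assumes "p \<in> forms n i" "linear_form n ^ j * p \<in> polys_on (outside_box n d)"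
    and "2 * int i + int j \<le> socle_degree n d"
  shows "p \<in> polys_on (outside_box n d)"
proof -
  let ?l = "linear_form n :: 'k mpoly" and ?s = "socle_degree n d"
  let ?F = "lowering n d :: 'k mpoly \<Rightarrow> 'k mpoly" and ?B = "polys_on (outside_box n d) :: 'k mpoly set"
  have l: "?l ^ k \<in> polys_on (mons n)" for k
    by (rule forms_power_polys_on_mons[OF linear_form_forms])
  \<comment> \<open>The last premise supplies \<open>?F p\<close> in the ideal; degree 0 and
    positive degree discharge it differently.\<close>
  have descend: "p \<in> ?B"
    if "p \<in> forms n i" "?l ^ j * p \<in> ?B" "2 * int i + int j \<le> ?s"
      "\<And>j. 2 * int i + int j \<le> ?s \<Longrightarrow> j > 0 \<Longrightarrow> ?l ^ j * p \<in> ?B \<Longrightarrow> ?F p \<in> ?B" for i j p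
    using that(2,3)
  proof (induction j)
    case (Suc j)
    have Fp: "?F p \<in> ?B"
      using that(4)[of "Suc j"] Suc.prems by simp
    define c where "c = int (Suc j) * (?s - 2 * int i - int j)"
    \<comment> \<open>The bound for \<open>Suc j\<close> says that s - 2i - j is at least 1.\<close>
    have "c > 0"
      unfolding c_def using Suc.prems(2) by (intro mult_pos_pos) auto
    have "?F (?l ^ Suc j * p) - ?l ^ Suc j * ?F p \<in> ?B"
      by (rule polys_on_diff[OF lowering_outside_box[OF Suc.prems(1)] outside_box_mult[OF l Fp]])
    then have *: "of_int c * (?l ^ j * p) \<in> ?B"
      unfolding lowering_linear_form_power[OF that(1)] c_def[symmetric] add_diff_cancel_left' .
    obtain u :: "'k mpoly" where u: "u \<in> forms n 0" "u * of_int c = 1"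
      using of_int_unit_mpoly[of c] \<open>c > 0\<close> by auto
    have "u * (of_int c * (?l ^ j * p)) \<in> ?B"
      by (rule outside_box_mult[OF forms_polys_on_mons[OF u(1)] *])
    then have "?l ^ j * p \<in> ?B"
      unfolding mult.assoc[of u, symmetric] u(2) mult_1_left .
    then show ?case using Suc by simp
  qed simp
  show ?thesis
    using assms
  proof (induction i arbitrary: j p)
    case 0
    show ?case
      by (rule descend[OF 0]) (simp add: lowering_forms_0[OF 0(1)])
  next
    case (Suc i)
    show ?case
    proof (rule descend[OF Suc.prems])
      fix j assume j: "2 * int (Suc i) + int j \<le> ?s" "j > 0" "?l ^ j * p \<in> ?B"
      then obtain k where k: "j = Suc k" by (cases j) auto
      define c where "c = int (Suc k) * (?s - 2 * int (Suc i) - int k)"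
      \<comment> \<open>The commutator formula for \<ell>^j, multiplied by \<ell> and solved for the
        term with \<open>?F p\<close>; all other terms lie in the ideal.\<close>
      have "?l ^ Suc j * ?F p = ?l * ?F (?l ^ j * p) - of_int c * (?l ^ j * p)"
        unfolding k lowering_linear_form_power[OF Suc.prems(1)] c_def[symmetric]
        by (simp add: algebra_simps)
      also have "\<dots> \<in> ?B"
        by (rule polys_on_diff[OF outside_box_mult[OF _ lowering_outside_box] of_int_mult_polys_on])
           (use l[of 1] j(3) in simp_all)
      finally show "?F p \<in> ?B"
        \<comment> \<open>Lowering the degree by 1 and raising the power by 1 decreases 2i + j, so
          the bound persists.\<close>
        using Suc.IH[OF lowering_forms_Suc[OF Suc.prems(1)], of "Suc j"] j(1) by auto
    qed
  qed
qed

text \<open>Downward induction on the target degree q, with an inner induction on the power. Given w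
  = \<ell>^k u modulo the ideal, the outer hypothesis writes \<ell>^(k+1) u as \<ell>^(k+2) v;
  applying \<open>F\<close> turns this into c \<ell>^k u = \<ell>^(k+1) y with c nonzero.\<close>

lemma box_surjective:
  fixes w :: "'k::field_char_0 mpoly"
  assumes "w \<in> forms n q" "j \<le> q" "2 * int q - int j \<ge> socle_degree n d"
  shows "\<exists>u\<in>forms n (q - j). w - linear_form n ^ j * u \<in> polys_on (outside_box n d)"
proof -
  let ?l = "linear_form n :: 'k mpoly" and ?s = "socle_degree n d"
  let ?F = "lowering n d :: 'k mpoly \<Rightarrow> 'k mpoly" and ?B = "polys_on (outside_box n d) :: 'k mpoly set"
  have l: "?l ^ k \<in> polys_on (mons n)" for k
    by (rule forms_power_polys_on_mons[OF linear_form_forms])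
  have "\<forall>w j. w \<in> forms n q \<longrightarrow> j \<le> q \<longrightarrow> 2 * int q - int j \<ge> ?s \<longrightarrow>
      (\<exists>u\<in>forms n (q - j). w - ?l ^ j * u \<in> ?B)"
  \<comment> \<open>The measure is 0 exactly when q exceeds the socle degree, where every form lies
    in the ideal.\<close>
  proof (induction "nat (?s + 1 - int q)" arbitrary: q)
    case 0
    have "\<exists>u\<in>forms n (q - j). w - ?l ^ j * u \<in> ?B" if "w \<in> forms n q" for w j
      using forms_gt_socle_degree[OF that, of d] 0
      by (intro bexI[of _ 0]) (auto simp: forms_eq_polys_on)
    then show ?case by blast
  next
    case (Suc r q)
    have IH: "\<exists>u\<in>forms n (Suc q - j). w - ?l ^ j * u \<in> ?B"
      if "w \<in> forms n (Suc q)" "j \<le> Suc q" "2 * int (Suc q) - int j \<ge> ?s" for w j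
      using Suc(1)[of "Suc q"] Suc(2) that by auto
    have "\<exists>u\<in>forms n (q - j). w - ?l ^ j * u \<in> ?B"
      if w: "w \<in> forms n q" and j: "j \<le> q" "2 * int q - int j \<ge> ?s" for w j
      using j
    proof (induction j)
      case 0
      show ?case by (rule bexI[of _ w]) (use w in auto)
    next
      case (Suc k)
      define i where "i = q - Suc k"
      have q: "q - k = Suc i" "q - Suc k = i" "int q = int k + int i + 1"
        "Suc k + Suc i = Suc q"
        using Suc.prems by (auto simp: i_def)
      obtain u where u: "u \<in> forms n (Suc i)" "w - ?l ^ k * u \<in> ?B"
        using Suc q by auto
      define c where "c = int (Suc k) * (?s - 2 * int (Suc i) - int k)"
      \<comment> \<open>With q = k + i + 1, the bound 2q - (k + 1) >= s says that s - 2 (i + 1) - k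
        <= -1.\<close>
      have "c < 0"
        unfolding c_def using Suc.prems(2) q(3) by (intro mult_pos_neg) auto
      have "?l ^ Suc k * u \<in> forms n (Suc q)"
        using forms_mult[OF forms_power[OF linear_form_forms, of n "Suc k"] u(1)]
        unfolding q(4)[symmetric] by (simp only: nat_mult_1_right)
      from IH[OF this, of "Suc (Suc k)"] obtain v
        where v: "v \<in> forms n i" "?l ^ Suc k * u - ?l ^ Suc (Suc k) * v \<in> ?B"
        using Suc.prems q by auto
      define c' where "c' = int (Suc (Suc k)) * (?s - 2 * int i - int (Suc k))"
      \<comment> \<open>After applying \<open>?F\<close> to both sides, every term except c \<ell>^k
        u contains \<ell>^(k+1); \<open>y\<close> collects the cofactors.\<close>
      define y where "y = ?l * ?F v + of_int c' * v - ?F u"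
      have lF: "?l * ?F v \<in> forms n i"
      proof (cases i)
        \<comment> \<open>There is no degree i - 1 here, but \<open>?F v\<close> vanishes.\<close>
        case 0
        then show ?thesis using lowering_forms_0[of v n d] v(1) by (simp add: forms_eq_polys_on)
      next
        case (Suc i')
        then show ?thesis
          using forms_mult[OF linear_form_forms lowering_forms_Suc, of v n i' d] v(1) by simp
      qed
      have y: "y \<in> forms n i"
        using lF lowering_forms_Suc[OF u(1)] v(1) unfolding y_def forms_eq_polys_on
        by (intro polys_on_diff polys_on_add of_int_mult_polys_on)
      have "?F (?l ^ Suc k * u) - ?F (?l ^ Suc (Suc k) * v) \<in> ?B"
        using lowering_outside_box[OF v(2)] by (simp only: lowering_diff)
      also have "?F (?l ^ Suc k * u) - ?F (?l ^ Suc (Suc k) * v)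
          = of_int c * (?l ^ k * u) - ?l ^ Suc k * y"
        unfolding lowering_linear_form_power[OF u(1)] lowering_linear_form_power[OF v(1)]
          c_def[symmetric] c'_def[symmetric] y_def by (simp add: algebra_simps)
      finally have *: "of_int c * (?l ^ k * u) - ?l ^ Suc k * y \<in> ?B" .
      obtain t :: "'k mpoly" where t: "t \<in> forms n 0" "t * of_int c = 1"
        using of_int_unit_mpoly[of c] \<open>c < 0\<close> by auto
      have "t * (of_int c * (?l ^ k * u) - ?l ^ Suc k * y) \<in> ?B"
        by (rule outside_box_mult[OF forms_polys_on_mons[OF t(1)] *])
      also have "t * (of_int c * (?l ^ k * u) - ?l ^ Suc k * y) =
          (t * of_int c) * (?l ^ k * u) - ?l ^ Suc k * (t * y)"
        by (simp add: algebra_simps)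
      finally have "?l ^ k * u - ?l ^ Suc k * (t * y) \<in> ?B"
        unfolding t(2) by simp
      from polys_on_add[OF u(2) this] have "w - ?l ^ Suc k * (t * y) \<in> ?B"
        by simp
      then show ?case
        using forms_mult[OF t(1) y] q(2) by auto
    qed
    then show ?case by blast
  qed
  with assms show ?thesis by blast
qed

subsection \<open>Quotients by homogeneous ideals\<close>

lemma mpoly_ring_power: "p [^]\<^bsub>mpoly_ring n\<^esub> (j::nat) = p ^ j"
  by (induction j) (simp_all add: nat_pow_def mpoly_ring_simps mult.commute)

lemma forms_in_carrier: "p \<in> forms n i \<Longrightarrow> p \<in> carrier (mpoly_ring n)"
  by (simp add: forms_def)

text \<open>The finitely many monomials in \<open>B\<close> span the quotient over the field, and
  ideals are subspaces because constants belong to the ring. A descending chain of subspaces of a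
  finite-dimensional space stabilizes.\<close>

lemma artinian_quotient:
  fixes I :: "'k::field mpoly set"
  assumes I: "ideal I (mpoly_ring n)" and B: "finite B" "B \<subseteq> mons n"
    and repr: "\<And>p. p \<in> carrier (mpoly_ring n) \<Longrightarrow> \<exists>q\<in>polys_on B. p - q \<in> I"
  shows "artinian_ring (mpoly_ring n Quot I)"
proof -
  interpret I: ideal I "mpoly_ring n" by (rule I)
  interpret h: ring_hom_ring "mpoly_ring n" "mpoly_ring n Quot I" "(+>\<^bsub>mpoly_ring n\<^esub>) I"
    by (rule I.rcos_ring_hom_ring)
  let ?c = "\<lambda>p. I +>\<^bsub>mpoly_ring n\<^esub> p"
  interpret V: vector_space "\<lambda>c p. Poly_Mapping.single 0 c * (p :: 'k mpoly)"
    by unfold_locales (simp_all add: distrib_left distrib_right single_add mult_single flip: mult.assoc)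
  have Bc: "p \<in> carrier (mpoly_ring n)" if "p \<in> polys_on B" for p :: "'k mpoly"
    using that B by (simp add: carrier_mpoly_ring polys_on_mono)
  have cc: "Poly_Mapping.single 0 c \<in> carrier (mpoly_ring n)" for c :: 'k
    by (simp add: carrier_mpoly_ring polys_on_single mons_closed)
  let ?T = "(\<lambda>b. Poly_Mapping.single b (1::'k)) ` B"
  have spanT: "p \<in> V.span ?T" if "p \<in> polys_on B" for p
    using that
  proof (induction rule: polys_on_induct)
    case (single m c)
    then have "Poly_Mapping.single 0 c * Poly_Mapping.single m 1 \<in> V.span ?T"
      by (intro V.span_scale V.span_base) auto
    then show ?case by (simp add: mult_single)
  qed (auto intro: V.span_zero V.span_add)
  show ?thesis
  proof (intro artinian_ring.intro artinian_ring_axioms.intro)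
    show "ring (mpoly_ring n Quot I)" by (rule I.quotient_is_ring)
  next
    fix K :: "nat \<Rightarrow> 'k mpoly set set"
    assume K: "\<And>i. ideal (K i) (mpoly_ring n Quot I)" and dec: "\<And>i. K (Suc i) \<subseteq> K i"
    have dec': "K j \<subseteq> K i" if "i \<le> j" for i j
      using dec that by (rule lift_Suc_antimono_le)
    \<comment> \<open>The chain is pulled back to the span of \<open>B\<close>, so that linear
      algebra takes place among polynomials instead of cosets.\<close>
    define W where "W i = {p \<in> polys_on B. ?c p \<in> K i}" for i
    have sub: "V.subspace (W i)" for i
    proof (rule V.subspaceI)
      interpret K: ideal "K i" "mpoly_ring n Quot I" by (rule K)
      show "0 \<in> W i"
        using K.zero_closed h.hom_zero by (simp add: W_def mpoly_ring_simps)
      show "p + q \<in> W i" if "p \<in> W i" "q \<in> W i" for p q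
        using that K.a_closed h.hom_add[of p q] by (simp add: W_def Bc polys_on_add mpoly_ring_simps)
      show "Poly_Mapping.single 0 c * p \<in> W i" if "p \<in> W i" for c p
      proof -
        have "Poly_Mapping.single 0 c * p \<in> polys_on B"
          using that by (intro polys_on_mult[OF polys_on_single[of 0 "{0}"], of p B]) (simp_all add: W_def)
        moreover have "?c (Poly_Mapping.single 0 c * p) \<in> K i"
          using that K.I_l_closed[of "?c p" "?c (Poly_Mapping.single 0 c)"]
            h.hom_mult[OF cc Bc, of p c] h.hom_closed[OF cc] by (simp add: W_def mpoly_ring_simps)
        ultimately show ?thesis by (simp add: W_def)
      qed
    qed
    have "\<forall>i. \<exists>b. b \<subseteq> W i \<and> V.independent b \<and> W i \<subseteq> V.span b"
    proof
      show "\<exists>b. b \<subseteq> W i \<and> V.independent b \<and> W i \<subseteq> V.span b" for i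
        by (rule V.maximal_independent_subset[of "W i"]) blast
    qed
    from choice[OF this] obtain b
      where "\<forall>i. b i \<subseteq> W i \<and> V.independent (b i) \<and> W i \<subseteq> V.span (b i)" ..
    then have b: "b i \<subseteq> W i" "V.independent (b i)" "W i \<subseteq> V.span (b i)" for i
      by auto
    have fin: "finite (b i)" for i
      using V.independent_span_bound[OF finite_imageI[OF B(1)] b(2)[of i]] spanT b(1)[of i]
      by (auto simp: W_def)
    \<comment> \<open>\<open>b i\<close> is a basis of \<open>W i\<close>, so \<open>N\<close> is an
      index of least dimension. A vector of \<open>W N\<close> missing from a later
      \<open>W i\<close> would extend \<open>b i\<close> to an independent set too large for the
      span of \<open>b N\<close>.\<close>
    obtain N where N: "\<forall>i. card (b N) \<le> card (b i)"
      using ex_has_least_nat[of "\<lambda>_. True" 0 "\<lambda>i. card (b i)"] by blast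
    have W: "W N \<subseteq> W i" if "N \<le> i" for i
    proof
      fix v assume v: "v \<in> W N"
      show "v \<in> W i"
      proof (rule ccontr)
        assume "v \<notin> W i"
        then have v': "v \<notin> V.span (b i)"
          using V.span_minimal[OF b(1) sub] by blast
        then have "V.independent (insert v (b i))"
          by (rule V.independent_insertI) (rule b(2))
        moreover have "insert v (b i) \<subseteq> V.span (b N)"
          using b(1)[of i] b(3)[of N] v dec'[OF that] by (auto simp: W_def)
        ultimately have "card (insert v (b i)) \<le> card (b N)"
          using V.independent_span_bound[OF fin] by blast
        moreover have "v \<notin> b i" using v' V.span_base by blast
        ultimately show False using spec[OF N, of i] fin by simp
      qed
    qed
    have "K N \<subseteq> K i" if "N \<le> i" for i
    proof
      fix x assume x: "x \<in> K N"
      then have "x \<in> carrier (mpoly_ring n Quot I)"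
        using ideal.Icarr[OF K] by blast
      then obtain p where p: "p \<in> carrier (mpoly_ring n)" "x = ?c p"
        unfolding FactRing_def using A_RCOSETS_def'[of "mpoly_ring n" I] by auto
      then obtain q where q: "q \<in> polys_on B" "p - q \<in> I" using repr by blast
      have "?c p = ?c q"
        using I.quotient_eq_iff_same_a_r_cos[OF I p(1) Bc[OF q(1)]] q
        by (simp add: mpoly_ring_diff Bc)
      then have "q \<in> W N" using x p q by (simp add: W_def)
      then show "x \<in> K i" using W[OF that] \<open>?c p = ?c q\<close> p by (auto simp: W_def)
    qed
    then show "\<exists>N. \<forall>i\<ge>N. K i = K N"
      using dec' by (meson subset_antisym)
  qed
qed

text \<open>Coset multiplication is computed on representatives. Differences of forms of one degree
  are again such forms, so injectivity reduces to a trivial kernel and surjectivity to solving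
  congruences modulo \<open>I\<close>.\<close>

lemma has_SLP_criterion:
  fixes I :: "'k::field mpoly set"
  assumes I: "ideal I (mpoly_ring n)"
    and "homogeneous_ideal n I" "artinian_ring (mpoly_ring n Quot I)"
    and l: "l \<in> forms n 1"
    and max_rank: "\<And>i j. (\<forall>p\<in>forms n i. l ^ j * p \<in> I \<longrightarrow> p \<in> I) \<or>
          (\<forall>w\<in>forms n (i + j). \<exists>u\<in>forms n i. w - l ^ j * u \<in> I)"
  shows "has_SLP n I"
proof -
  let ?R = "mpoly_ring n :: 'k mpoly ring"
  let ?c = "\<lambda>p. I +>\<^bsub>?R\<^esub> p"
  interpret I: ideal I ?R by (rule I)
  interpret h: ring_hom_ring ?R "?R Quot I" ?c
    by (rule I.rcos_ring_hom_ring)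
  have eq_iff: "?c p = ?c q \<longleftrightarrow> p - q \<in> I" if "p \<in> carrier ?R" "q \<in> carrier ?R" for p q
    using I.quotient_eq_iff_same_a_r_cos[OF I that] that by (simp add: mpoly_ring_diff)
  have lc: "l ^ j \<in> carrier ?R" for j
    using forms_power[OF l] by (rule forms_in_carrier)
  have mult: "?c l [^]\<^bsub>?R Quot I\<^esub> j \<otimes>\<^bsub>?R Quot I\<^esub> ?c p = ?c (l ^ j * p)"
    if "p \<in> forms n i" for p i and j :: nat
    using h.hom_nat_pow[of l j] lc[of 1] h.hom_mult[OF lc forms_in_carrier[OF that], of j]
    by (simp add: mpoly_ring_power mpoly_ring_simps)
  have lf: "l ^ j * p \<in> forms n (i + j)" if "p \<in> forms n i" for p i j
    using forms_mult[OF forms_power[OF l, of j] that] by (simp add: add.commute)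
  have "let \<phi> = (\<lambda>u. (?c l [^]\<^bsub>?R Quot I\<^esub> j) \<otimes>\<^bsub>?R Quot I\<^esub> u)
        in inj_on \<phi> (graded_part n I i) \<or> \<phi> ` graded_part n I i = graded_part n I (i + j)"
    for i j :: nat
    using max_rank[of i j]
  proof
    assume inj: "\<forall>p\<in>forms n i. l ^ j * p \<in> I \<longrightarrow> p \<in> I"
    have "inj_on (\<lambda>u. (?c l [^]\<^bsub>?R Quot I\<^esub> j) \<otimes>\<^bsub>?R Quot I\<^esub> u) (graded_part n I i)"
    proof (rule inj_onI)
      fix x y
      assume "x \<in> graded_part n I i" "y \<in> graded_part n I i"
      then obtain p q where p: "p \<in> forms n i" "x = ?c p" and q: "q \<in> forms n i" "y = ?c q"
        by (auto simp: graded_part_def)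
      assume "(?c l [^]\<^bsub>?R Quot I\<^esub> j) \<otimes>\<^bsub>?R Quot I\<^esub> x = (?c l [^]\<^bsub>?R Quot I\<^esub> j) \<otimes>\<^bsub>?R Quot I\<^esub> y"
      then have "l ^ j * p - l ^ j * q \<in> I"
        using p q eq_iff[OF forms_in_carrier[OF lf[OF p(1)]] forms_in_carrier[OF lf[OF q(1)]]]
        by (simp add: mult)
      then have "l ^ j * (p - q) \<in> I" by (simp add: right_diff_distrib)
      moreover have "p - q \<in> forms n i"
        using p q by (simp add: forms_eq_polys_on polys_on_diff)
      ultimately have "p - q \<in> I" using inj by blast
      then show "x = y" using p q by (simp add: eq_iff forms_in_carrier)
    qed
    then show ?thesis by (simp add: Let_def)
  next
    assume surj: "\<forall>w\<in>forms n (i + j). \<exists>u\<in>forms n i. w - l ^ j * u \<in> I"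
    have "(\<lambda>u. (?c l [^]\<^bsub>?R Quot I\<^esub> j) \<otimes>\<^bsub>?R Quot I\<^esub> u) ` graded_part n I i = graded_part n I (i + j)"
    proof (intro equalityI subsetI)
      fix x assume "x \<in> (\<lambda>u. (?c l [^]\<^bsub>?R Quot I\<^esub> j) \<otimes>\<^bsub>?R Quot I\<^esub> u) ` graded_part n I i"
      then show "x \<in> graded_part n I (i + j)"
        using lf by (auto simp: graded_part_def mult)
    next
      fix x assume "x \<in> graded_part n I (i + j)"
      then obtain w where w: "w \<in> forms n (i + j)" "x = ?c w" by (auto simp: graded_part_def)
      then obtain u where u: "u \<in> forms n i" "w - l ^ j * u \<in> I" using surj by blast
      then have "x = ?c (l ^ j * u)"
        using w eq_iff[OF forms_in_carrier[OF w(1)] forms_in_carrier[OF lf[OF u(1)]]] by simp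
      then show "x \<in> (\<lambda>u. (?c l [^]\<^bsub>?R Quot I\<^esub> j) \<otimes>\<^bsub>?R Quot I\<^esub> u) ` graded_part n I i"
        using u by (auto simp: graded_part_def mult[OF u(1), symmetric])
    qed
    then show ?thesis by (simp add: Let_def)
  qed
  then show ?thesis
    unfolding has_SLP_def using assms(2,3) l by (auto simp: graded_part_def)
qed

subsection \<open>The almost complete intersection\<close>

text \<open>The exponents of the monomials in \<open>J\<close> when n >= 2, as
  \<open>genideal_eq_killed\<close> confirms.\<close>

definition killed :: "nat \<Rightarrow> nat \<Rightarrow> (nat \<Rightarrow>\<^sub>0 nat) set" where
  "killed n a = {m \<in> mons n. (\<exists>i\<in>{1..n}. a \<le> Poly_Mapping.lookup m i) \<or>
     (a - 1 \<le> Poly_Mapping.lookup m 1 \<and> 1 \<le> Poly_Mapping.lookup m 2)}"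

lemma killed_subset_mons: "killed n a \<subseteq> mons n"
  by (auto simp: killed_def)

lemma killed_add: "u \<in> killed n a \<Longrightarrow> m \<in> mons n \<Longrightarrow> m + u \<in> killed n a"
  by (auto simp: killed_def mons_closed lookup_add intro: trans_le_add2)

lemma killed_mult:
  "p \<in> polys_on (mons n) \<Longrightarrow> q \<in> polys_on (killed n a) \<Longrightarrow> p * q \<in> polys_on (killed n a)"
  by (erule (1) polys_on_mult) (rule killed_add)

lemma indet_power: "indet i ^ k = Poly_Mapping.single (Poly_Mapping.single i k) 1"
  by (induction k) (simp_all add: indet_def mult_single single_add[symmetric])

definition generator_exponents :: "nat \<Rightarrow> nat \<Rightarrow> (nat \<Rightarrow>\<^sub>0 nat) set" where
  "generator_exponents n a = (\<lambda>i. Poly_Mapping.single i a) ` {1..n}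
     \<union> {Poly_Mapping.single 1 (a - 1) + Poly_Mapping.single 2 1}"

lemma generator_exponents_mons: "n \<ge> 2 \<Longrightarrow> generator_exponents n a \<subseteq> mons n"
  by (auto simp: generator_exponents_def mons_closed)

lemma generators_eq:
  "{indet i ^ a | i. i \<in> {1..n}} \<union> {indet 1 ^ (a - 1) * indet 2}
     = (\<lambda>g. Poly_Mapping.single g (1 :: 'k::comm_ring_1)) ` generator_exponents n a"
proof -
  have "(indet 1 ^ (a - 1) * indet 2 :: 'k mpoly)
      = Poly_Mapping.single (Poly_Mapping.single 1 (a - 1) + Poly_Mapping.single 2 1) 1"
    unfolding indet_power by (simp add: indet_def mult_single)
  then show ?thesis
    by (auto simp: generator_exponents_def indet_power image_Un)
qed

lemma killed_eq_multiples:
  assumes "n \<ge> 2"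
  shows "killed n a = {g + m | g m. g \<in> generator_exponents n a \<and> m \<in> mons n}" (is "_ = ?U")
proof (intro equalityI subsetI)
  fix m assume m: "m \<in> killed n a"
  \<comment> \<open>Divisibility of monomials is the componentwise order, with cofactor exponent
    \<open>m - g\<close>.\<close>
  have ex: "m \<in> ?U" if "g \<in> generator_exponents n a" "\<And>i. Poly_Mapping.lookup g i \<le> Poly_Mapping.lookup m i" for g
  proof -
    have "m = g + (m - g)"
      using that(2) by (intro poly_mapping_eqI) (simp add: lookup_add lookup_minus)
    then show ?thesis using that(1) m mons_diff[of m n g] killed_subset_mons by blast
  qed
  from m consider i where "i \<in> {1..n}" "a \<le> Poly_Mapping.lookup m i"
    | "a - 1 \<le> Poly_Mapping.lookup m 1" "1 \<le> Poly_Mapping.lookup m 2"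
    by (auto simp: killed_def)
  then show "m \<in> ?U"
  proof cases
    case 1
    then show ?thesis
      by (intro ex[of "Poly_Mapping.single i a"])
         (auto simp: generator_exponents_def lookup_single when_def)
  next
    case 2
    then show ?thesis
      by (intro ex[of "Poly_Mapping.single 1 (a - 1) + Poly_Mapping.single 2 1"])
         (auto simp: generator_exponents_def lookup_single lookup_add when_def)
  qed
next
  fix u assume "u \<in> ?U"
  then obtain g m where u: "u = m + g" "g \<in> generator_exponents n a" "m \<in> mons n"
    by (auto simp: add.commute)
  have "g \<in> mons n" using u(2) generator_exponents_mons[OF assms] by blast
  then have "g \<in> killed n a"
    using u(2) by (force simp: killed_def generator_exponents_def lookup_single lookup_add)
  then show "u \<in> killed n a" unfolding u(1) using u(3) by (rule killed_add)
qed

lemma genideal_eq_killed: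
  assumes "n \<ge> 2"
  shows "Idl\<^bsub>mpoly_ring n\<^esub> ({indet i ^ a | i. i \<in> {1..n}} \<union> {indet 1 ^ (a - 1) * indet 2})
    = (polys_on (killed n a) :: 'k::comm_ring_1 mpoly set)"
  unfolding generators_eq killed_eq_multiples[OF assms]
  by (rule genideal_monomials[OF generator_exponents_mons[OF assms]])

section \<open>Homogeneity, finiteness and normal forms\<close>

lemma homogeneous_ideal_monomials:
  assumes "G \<subseteq> mons n"
  shows "homogeneous_ideal n
    (Idl\<^bsub>mpoly_ring n\<^esub> ((\<lambda>g. Poly_Mapping.single g (1::'k::comm_ring_1)) ` G))"
  unfolding homogeneous_ideal_def
proof (intro exI conjI)
  show "(\<lambda>g. Poly_Mapping.single g (1::'k)) ` G \<subseteq> (\<Union>d. forms n d)"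
    using assms by (auto simp: forms_eq_polys_on intro!: polys_on_single)
qed simp

lemma finite_mons_bounded:
  "finite {m \<in> mons n. \<forall>i\<in>{1..n}. Poly_Mapping.lookup m i < a}"
proof (rule finite_imageD)
  let ?S = "{m \<in> mons n. \<forall>i\<in>{1..n}. Poly_Mapping.lookup m i < a}"
  have *: "Poly_Mapping.lookup m i = 0" if "m \<in> mons n" "i \<notin> {1..n}" for m i
    using that by (auto simp: mons_def in_keys_iff)
  have "Poly_Mapping.lookup ` ?S \<subseteq> {f. \<forall>i. (i \<in> {1..n} \<longrightarrow> f i \<in> {..<a}) \<and> (i \<notin> {1..n} \<longrightarrow> f i = 0)}"
    using * by auto
  then show "finite (Poly_Mapping.lookup ` ?S)"
    by (rule finite_subset) (intro finite_set_of_finite_funs finite_atLeastAtMost finite_lessThan)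
  show "inj_on Poly_Mapping.lookup ?S"
    by (auto intro: inj_onI poly_mapping_eqI)
qed

text \<open>Provides normal forms modulo a monomial ideal: terms over \<open>U\<close> are kept, the
  others fall into \<open>W\<close>.\<close>

lemma polys_on_split:
  assumes "p \<in> polys_on (U \<union> W)"
  shows "\<exists>q\<in>polys_on U. p - q \<in> polys_on W"
  using assms
proof (induction rule: polys_on_induct)
  case zero
  show ?case by (intro bexI[of _ 0]) auto
next
  case (single m c)
  show ?case
  proof (cases "m \<in> U")
    case True
    then show ?thesis
      by (intro bexI[of _ "Poly_Mapping.single m c"]) (auto intro: polys_on_single)
  next
    case False
    then show ?thesis using single
      by (intro bexI[of _ 0]) (auto intro: polys_on_single)
  qed
next
  case (add p p')
  then obtain q q' where "q \<in> polys_on U" "p - q \<in> polys_on W" "q' \<in> polys_on U" "p' - q' \<in> polys_on W"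
    by blast
  moreover have "(p + p') - (q + q') = (p - q) + (p' - q')" by simp
  ultimately show ?case
    by (metis polys_on_add)
qed

text \<open>Multiplying by a monomial shifts exponents injectively, so coefficients do not mix; this
  makes a colon by a monomial readable from exponents.\<close>

lemma lookup_single_mult:
  "Poly_Mapping.lookup (Poly_Mapping.single g 1 * q) (g + m) = Poly_Mapping.lookup (q :: 'k::comm_ring_1 mpoly) m"
proof -
  have "q \<in> polys_on UNIV" by (simp add: polys_on_def)
  then show ?thesis
    by (induction rule: polys_on_induct)
       (auto simp: mult_single lookup_single distrib_left lookup_add when_def)
qed

text \<open>\<open>quotient_box\<close> and \<open>colon_box\<close> are the exponents of \<open>(J, x\<^sub>1^(a-1))\<close> and \<open>(J : x\<^sub>1^(a-1))\<close>.\<close>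

definition quotient_box :: "nat \<Rightarrow> nat \<Rightarrow> nat" where
  "quotient_box a = (\<lambda>_. a)(1 := a - 1)"

definition colon_box :: "nat \<Rightarrow> nat \<Rightarrow> nat" where
  "colon_box a = (\<lambda>_. a)(1 := 1, 2 := 1)"

section \<open>The two ends of the exact sequence\<close>

lemma interval_split: "n \<ge> 2 \<Longrightarrow> {1..n} = insert 1 (insert 2 {3..(n::nat)})"
  by auto

lemma socle_degree_boxes:
  assumes "n \<ge> 2" "a \<ge> 1"
  shows "socle_degree n (quotient_box a) = int n * (int a - 1) - 1"
    and "socle_degree n (colon_box a) = (int n - 2) * (int a - 1)"
  unfolding socle_degree_def interval_split[OF assms(1)] using assms
  by (simp_all add: quotient_box_def colon_box_def of_nat_diff algebra_simps)

text \<open>Both x_1^a and x_1^(a-1) x_2 are multiples of x_1^(a-1); the other generators are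
  shared.\<close>

lemma killed_subset_quotient_box:
  assumes "a \<ge> 1" "n \<ge> 2"
  shows "killed n a \<subseteq> outside_box n (quotient_box a)"
proof
  fix m assume m: "m \<in> killed n a"
  then consider i where "i \<in> {1..n}" "a \<le> Poly_Mapping.lookup m i"
    | "a - 1 \<le> Poly_Mapping.lookup m 1"
    by (auto simp: killed_def)
  then have "\<exists>i\<in>{1..n}. quotient_box a i \<le> Poly_Mapping.lookup m i"
  proof cases
    case 1
    then show ?thesis by (intro bexI[of _ i]) (auto simp: quotient_box_def)
  next
    case 2
    then show ?thesis using assms by (intro bexI[of _ 1]) (auto simp: quotient_box_def)
  qed
  then show "m \<in> outside_box n (quotient_box a)"
    using m by (simp add: killed_def outside_box_def)
qed

lemma quotient_box_cases:
  assumes "m \<in> outside_box n (quotient_box a)"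
  shows "m \<in> killed n a \<or> a - 1 \<le> Poly_Mapping.lookup m 1"
  using assms by (auto simp: killed_def outside_box_def quotient_box_def split: if_splits)

text \<open>With a - 1 added to the first exponent, the bound a is reached as soon as x_1 divides
  the monomial, and the mixed generator only asks for x_2. Divisibility by x_2^a is subsumed since a
  >= 1.\<close>

lemma colon_box_iff:
  assumes "a \<ge> 1" "n \<ge> 2"
  shows "Poly_Mapping.single 1 (a - 1) + m \<in> killed n a \<longleftrightarrow> m \<in> outside_box n (colon_box a)"
    (is "?g + m \<in> _ \<longleftrightarrow> _")
proof -
  have split: "(\<exists>i\<in>{1..n}. P i) \<longleftrightarrow> P 1 \<or> P 2 \<or> (\<exists>i\<in>{3..n}. P i)" for P :: "nat \<Rightarrow> bool"
    unfolding interval_split[OF assms(2)] by simp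
  have lookup1: "Poly_Mapping.lookup (?g + m) 1 = a - 1 + Poly_Mapping.lookup m 1"
    and lookup: "\<And>i. i \<noteq> 1 \<Longrightarrow> Poly_Mapping.lookup (?g + m) i = Poly_Mapping.lookup m i"
    by (simp_all add: lookup_add lookup_single)
  have rest: "(\<exists>i\<in>{3..n}. a \<le> Poly_Mapping.lookup (?g + m) i)
      \<longleftrightarrow> (\<exists>i\<in>{3..n}. colon_box a i \<le> Poly_Mapping.lookup m i)"
    by (intro bex_cong refl) (auto simp: lookup_add lookup_single colon_box_def)
  have boxes: "colon_box a 1 = 1" "colon_box a 2 = 1"
    by (simp_all add: colon_box_def)
  have lookup2: "Poly_Mapping.lookup (?g + m) 2 = Poly_Mapping.lookup m 2"
    by (rule lookup) simp
  have mons: "?g + m \<in> mons n \<longleftrightarrow> m \<in> mons n"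
    unfolding mons_add_iff using assms(2) mons_closed(3)[of 1 n "a - 1"] by simp
  have "a \<le> a - 1 + Poly_Mapping.lookup m 1 \<longleftrightarrow> 1 \<le> Poly_Mapping.lookup m 1"
    using assms(1) by linarith
  then show ?thesis
    unfolding killed_def outside_box_def mem_Collect_eq split rest lookup1 lookup2 boxes mons
    using assms(1) by linarith
qed

text \<open>Well-definedness and injectivity of the first map of the exact sequence.\<close>

lemma colon_box_polys:
  fixes q :: "'k::comm_ring_1 mpoly"
  assumes "a \<ge> 1" "n \<ge> 2"
  shows "Poly_Mapping.single (Poly_Mapping.single 1 (a - 1)) 1 * q \<in> polys_on (killed n a)
    \<longleftrightarrow> q \<in> polys_on (outside_box n (colon_box a))"
    (is "?X * q \<in> _ \<longleftrightarrow> _")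
proof
  assume *: "?X * q \<in> polys_on (killed n a)"
  show "q \<in> polys_on (outside_box n (colon_box a))"
    unfolding polys_on_iff_lookup
    using * lookup_single_mult[of "Poly_Mapping.single 1 (a - 1)" q] colon_box_iff[OF assms]
    by (metis polys_on_iff_lookup)
next
  assume "q \<in> polys_on (outside_box n (colon_box a))"
  then show "?X * q \<in> polys_on (killed n a)"
    by (intro polys_on_mult[OF polys_on_single[of _ "{Poly_Mapping.single 1 (a - 1)}"]])
       (use colon_box_iff[OF assms] in auto)
qed

text \<open>Exactness in the middle, with control of degrees. The disjunction keeps e - (a - 1) from
  truncating: below degree a - 1 no multiple of x_1^(a-1) occurs and \<open>r\<close> is already in
  \<open>J\<close>.\<close>

lemma quotient_box_polys:
  fixes r :: "'k::comm_ring_1 mpoly"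
  assumes r: "r \<in> forms n e" "r \<in> polys_on (outside_box n (quotient_box a))"
  shows "r \<in> polys_on (killed n a) \<or> (a - 1 \<le> e \<and> (\<exists>q\<in>forms n (e - (a - 1)).
    r - Poly_Mapping.single (Poly_Mapping.single 1 (a - 1)) 1 * q \<in> polys_on (killed n a)))"
proof (cases "a - 1 \<le> e")
  case True
  let ?X = "Poly_Mapping.single (Poly_Mapping.single 1 (a - 1)) (1::'k)"
  let ?P = "\<lambda>r. \<exists>q\<in>forms n (e - (a - 1)). r - ?X * q \<in> polys_on (killed n a)"
  have "r \<in> polys_on {m \<in> outside_box n (quotient_box a). mon_degree m = e}"
    using r by (auto simp: forms_eq_polys_on polys_on_def)
  then have "?P r"
  proof (induction rule: polys_on_induct)
    case zero
    show ?case by (intro bexI[of _ 0]) (auto simp: forms_eq_polys_on)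
  next
    case (single m c)
    show ?case
    proof (cases "m \<in> killed n a")
      case True
      then show ?thesis
        by (intro bexI[of _ 0]) (auto simp: forms_eq_polys_on intro: polys_on_single)
    next
      case False
      define m' where "m' = m - Poly_Mapping.single 1 (a - 1)"
      \<comment> \<open>Since \<open>m\<close> is not in \<open>killed n a\<close>, x_1^(a-1)
        divides it and the subtraction is exact.\<close>
      have m: "m = Poly_Mapping.single 1 (a - 1) + m'"
        using quotient_box_cases[of m n a] single False
        by (intro poly_mapping_eqI) (auto simp: m'_def lookup_add lookup_minus lookup_single when_def)
      have "m' \<in> mons n"
        using single by (auto simp: m'_def outside_box_def mons_diff)
      moreover have "a - 1 + mon_degree m' = e"
        using single arg_cong[OF m, of mon_degree]
        unfolding mon_degree_add mon_degree_single mem_Collect_eq by presburger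
      then have "mon_degree m' = e - (a - 1)" by linarith
      ultimately show ?thesis
        by (intro bexI[of _ "Poly_Mapping.single m' c"])
           (auto simp: m mult_single forms_eq_polys_on intro: polys_on_single)
    qed
  next
    case (add p p')
    then obtain q q' where q: "q \<in> forms n (e - (a - 1))" "p - ?X * q \<in> polys_on (killed n a)"
      "q' \<in> forms n (e - (a - 1))" "p' - ?X * q' \<in> polys_on (killed n a)"
      by blast
    have "(p + p') - ?X * (q + q') \<in> polys_on (killed n a)"
      using polys_on_add[OF q(2,4)] by (simp add: algebra_simps)
    then show ?case
      using q by (intro bexI[of _ "q + q'"]) (auto simp: forms_eq_polys_on polys_on_add)
  qed
  with True show ?thesis by blast
next
  case False
  have "m \<in> killed n a" if "m \<in> Poly_Mapping.keys r" for m
  proof -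
    have m: "m \<in> mons n" "mon_degree m = e" "m \<in> outside_box n (quotient_box a)"
      using r that by (auto simp: forms_eq_polys_on polys_on_def)
    have "Poly_Mapping.lookup m 1 \<le> mon_degree m"
      by (cases "1 \<in> Poly_Mapping.keys m")
         (auto simp: mon_degree_def in_keys_iff intro: member_le_sum)
    then show ?thesis using quotient_box_cases[OF m(3)] m False by linarith
  qed
  then show ?thesis by (auto simp: polys_on_def)
qed

text \<open>Diagram chase: \<open>p\<close> vanishes in the quotient end, so it is x_1^(a-1) q
  modulo \<open>J\<close>; then \<ell>^j q vanishes in the colon end, hence so does q.\<close>

lemma killed_injective:
  fixes p :: "'k::field_char_0 mpoly"
  assumes na: "a \<ge> 1" "n \<ge> 2" and p: "p \<in> forms n i"
    and lp: "linear_form n ^ j * p \<in> polys_on (killed n a)"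
    and ij: "2 * int i + int j \<le> int n * (int a - 1) - 1"
  shows "p \<in> polys_on (killed n a)"
proof -
  let ?l = "linear_form n :: 'k mpoly" and ?J = "polys_on (killed n a) :: 'k mpoly set"
  let ?X = "Poly_Mapping.single (Poly_Mapping.single 1 (a - 1)) (1::'k)"
  have "p \<in> polys_on (outside_box n (quotient_box a))"
    by (rule box_injective[OF p polys_on_mono[OF lp killed_subset_quotient_box[OF na]]])
       (use na ij in \<open>simp add: socle_degree_boxes\<close>)
  from quotient_box_polys[OF p this] show ?thesis
  proof (elim disjE conjE bexE)
    fix q assume e: "a - 1 \<le> i" and q: "q \<in> forms n (i - (a - 1))" "p - ?X * q \<in> ?J"
    have "?l ^ j * p - ?l ^ j * (p - ?X * q) \<in> ?J"
      by (intro polys_on_diff lp killed_mult[OF forms_power_polys_on_mons[OF linear_form_forms] q(2)])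
    then have "?X * (?l ^ j * q) \<in> ?J"
      by (simp add: algebra_simps)
    then have "?l ^ j * q \<in> polys_on (outside_box n (colon_box a))"
      by (simp only: colon_box_polys[OF na])
    then have "q \<in> polys_on (outside_box n (colon_box a))"
      by (rule box_injective[OF q(1)])
         \<comment> \<open>After the degree shift the colon end requires 2i + j <= n (a - 1), which
           \<open>ij\<close> implies.\<close>
         (use na e ij in \<open>simp add: socle_degree_boxes of_nat_diff algebra_simps\<close>)
    then have "?X * q \<in> ?J" by (simp only: colon_box_polys[OF na])
    from polys_on_add[OF q(2) this] show ?thesis by simp
  qed
qed

text \<open>Diagram chase: a preimage u in the quotient end leaves an error x_1^(a-1) q, and a
  preimage v of q in the colon end corrects u to u + x_1^(a-1) v.\<close>

lemma killed_surjective: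
  fixes w :: "'k::field_char_0 mpoly"
  assumes na: "a \<ge> 1" "n \<ge> 2" and w: "w \<in> forms n (i + j)"
    and ij: "2 * int i + int j \<ge> int n * (int a - 1)"
  shows "\<exists>u\<in>forms n i. w - linear_form n ^ j * u \<in> polys_on (killed n a)"
proof -
  let ?l = "linear_form n :: 'k mpoly" and ?J = "polys_on (killed n a) :: 'k mpoly set"
  let ?X = "Poly_Mapping.single (Poly_Mapping.single 1 (a - 1)) (1::'k)"
  have X: "?X \<in> forms n (a - 1)"
    using na by (auto simp: forms_eq_polys_on mons_closed intro!: polys_on_single)
  obtain u where u: "u \<in> forms n i" "w - ?l ^ j * u \<in> polys_on (outside_box n (quotient_box a))"
    using box_surjective[OF w, of j "quotient_box a"] ij na by (auto simp: socle_degree_boxes)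
  have "w - ?l ^ j * u \<in> forms n (i + j)"
    using forms_mult[OF forms_power[OF linear_form_forms, of n j] u(1)] w
    by (simp add: forms_eq_polys_on polys_on_diff add.commute)
  from quotient_box_polys[OF this u(2)] show ?thesis
  proof (elim disjE conjE bexE)
    assume "w - ?l ^ j * u \<in> ?J"
    with u(1) show ?thesis by blast
  next
    fix q assume e: "a - 1 \<le> i + j" and q: "q \<in> forms n (i + j - (a - 1))"
      "w - ?l ^ j * u - ?X * q \<in> ?J"
    show ?thesis
    proof (cases "a - 1 \<le> i")
      case True
      have deg: "i + j - (a - 1) - j = i - (a - 1)" "j \<le> i + j - (a - 1)"
        using True by linarith+
      \<comment> \<open>The left side is 2i + j - 2 (a - 1), so the bound \<open>ij\<close> is
        exactly what the colon end needs.\<close>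
      have "2 * int (i + j - (a - 1)) - int j \<ge> socle_degree n (colon_box a)"
        using ij na True by (simp add: socle_degree_boxes of_nat_diff algebra_simps)
      then obtain v where v: "v \<in> forms n (i - (a - 1))"
        "q - ?l ^ j * v \<in> polys_on (outside_box n (colon_box a))"
        using box_surjective[OF q(1) deg(2), of "colon_box a"] unfolding deg(1) by auto
      have "?X * v \<in> forms n i"
        using forms_mult[OF X v(1)] True by simp
      moreover from v(2) have "?X * (q - ?l ^ j * v) \<in> ?J"
        by (simp only: colon_box_polys[OF na])
      from polys_on_add[OF q(2) this] have "w - ?l ^ j * (u + ?X * v) \<in> ?J"
        by (simp add: algebra_simps)
      ultimately show ?thesis
        using u(1) by (intro bexI[of _ "u + ?X * v"]) (auto simp: forms_eq_polys_on polys_on_add)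
    next
      case False
      \<comment> \<open>No source degree i - (a - 1) exists, but i < a - 1 together with
        \<open>ij\<close> pushes the degree of q beyond the socle degree of the colon end.\<close>
      have "q \<in> polys_on (outside_box n (colon_box a))"
        using q(1) by (rule forms_gt_socle_degree)
          (use e False ij na in \<open>simp add: socle_degree_boxes of_nat_diff algebra_simps\<close>)
      then have "?X * q \<in> ?J" by (simp only: colon_box_polys[OF na])
      from polys_on_add[OF q(2) this] show ?thesis using u(1) by auto
    qed
  qed
qed

theorem theorem5:
  fixes n a :: nat
  assumes "n \<ge> 2" and "a \<ge> 1"
  shows "has_SLP n (Idl\<^bsub>mpoly_ring n\<^esub>
           ({indet i ^ a | i. i \<in> {1..n}} \<union> {indet 1 ^ (a - 1) * indet 2})
           :: ('k::field_char_0 mpoly) set)"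
proof (rule has_SLP_criterion)
  let ?J = "Idl\<^bsub>mpoly_ring n\<^esub>
           ({indet i ^ a | i. i \<in> {1..n}} \<union> {indet 1 ^ (a - 1) * indet 2}) :: 'k mpoly set"
  note J = genideal_eq_killed[OF assms(1), of a, where 'k = 'k]
  show id: "ideal ?J (mpoly_ring n)"
    unfolding J by (intro ideal_polys_on killed_subset_mons killed_add)
  show "homogeneous_ideal n ?J"
    unfolding generators_eq
    by (rule homogeneous_ideal_monomials[OF generator_exponents_mons[OF assms(1)]])
  show "artinian_ring (mpoly_ring n Quot ?J)"
  proof (rule artinian_quotient[OF id finite_mons_bounded[of n a]])
    fix p :: "'k mpoly"
    assume "p \<in> carrier (mpoly_ring n)"
    then have "p \<in> polys_on ({m \<in> mons n. \<forall>i\<in>{1..n}. Poly_Mapping.lookup m i < a} \<union> killed n a)"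
      unfolding carrier_mpoly_ring by (rule polys_on_mono) (auto simp: killed_def not_less)
    from polys_on_split[OF this]
    show "\<exists>q\<in>polys_on {m \<in> mons n. \<forall>i\<in>{1..n}. Poly_Mapping.lookup m i < a}. p - q \<in> ?J"
      unfolding J .
  qed auto
  show "linear_form n \<in> (forms n 1 :: 'k mpoly set)"
    by (rule linear_form_forms)
  show "(\<forall>p\<in>forms n i. linear_form n ^ j * p \<in> ?J \<longrightarrow> p \<in> ?J) \<or>
      (\<forall>w\<in>forms n (i + j). \<exists>u\<in>forms n i. w - linear_form n ^ j * u \<in> ?J)" for i j
  \<comment> \<open>The centres differ by 1/2, so the two integer bounds leave no gap: where
    injectivity stops, surjectivity starts.\<close>
  proof (cases "2 * int i + int j \<le> int n * (int a - 1) - 1")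
    case True
    then show ?thesis
      unfolding J using killed_injective[OF assms(2,1), of _ i j] by (intro disjI1 ballI impI)
  next
    case False
    then have "2 * int i + int j \<ge> int n * (int a - 1)" by linarith
    then show ?thesis
      unfolding J using killed_surjective[OF assms(2,1), of _ i j] by (intro disjI2 ballI)
  qed
qed

end
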